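(* Let $X$ be a nonempty set and let $s,t\in \mathrm{PT}(X)\setminus\{\hat0\}$. Then $s\langle\hat\times t\rangle\in \mathrm{PT}(X)$ and $[s]_{\mathrm{AC}}\times_{\mathrm{rd}}[t]_{\mathrm{AC}}=[s\langle\hat\times t\rangle]_{\mathrm{AC}}$.
   Context: Terms. $\mathrm{T}(X)$ is the set of all terms built from elements of $X$, constants $\hat 0,\hat 1$, and binary symbols $\hat+,\hat\times$ (infix). $\mathrm{size}(t)$ is the total number of occurrences of symbols (elements of $X$, constants, binary symbols) in $t$. Simple terms. $s\in \mathrm{T}(X)$ is simple if $s=\hat 0$, or $s$ contains neither $\hat 0$ nor any subterm of the form $\hat 1\hat\times s'$ or $s'\hat\times\hat 1$. $\mathrm{ST}(X)$ is the set of simple terms. For $s,t\in \mathrm{ST}(X)$, $s=_{\mathrm{AC}}t$ means that $t$ is obtained from $s$ by finitely many steps, each replacing a subterm occurrence using, in either direction, one of: $a\hat+(b\hat+c)\leftrightarrow(a\hat+b)\hat+c$, $a\hat+b\leftrightarrow b\hat+a$, $a\hat\times(b\hat\times c)\leftrightarrow(a\hat\times b)\hat\times c$. $[s]_{\mathrm{AC}}$ is the class of $s$; $\mathbb{N}_{\mathrm{sb}}[X]=\mathrm{ST}(X)/{=_{\mathrm{AC}}}$; $0=[\hat 0]_{\mathrm{AC}}$, $1=[\hat 1]_{\mathrm{AC}}$; $X/\mathrm{AC}=\{[x]_{\mathrm{AC}}\mid x\in X\}$; $\mathrm{size}([s]_{\mathrm{AC}})=\mathrm{size}(s)$ (well defined).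 Operations on $\mathbb{N}_{\mathrm{sb}}[X]$: $p+0=0+p=p$, and $[s]_{\mathrm{AC}}+[t]_{\mathrm{AC}}=[s\hat+t]_{\mathrm{AC}}$ for $s,t\neq\hat 0$; $p\times 0=0\times p=0$, $p\times1=1\times p=p$, and $[s]_{\mathrm{AC}}\times[t]_{\mathrm{AC}}=[s\hat\times t]_{\mathrm{AC}}$ for $s,t\notin\{\hat 0,\hat 1\}$. Polynomials. A monomial term is a term built from elements of $X$ using only $\hat\times$; a monomial is the class of a monomial term. The set $\mathrm{PT}(X)$ of polynomial terms is the smallest $U\subseteq \mathrm{ST}(X)$ with: (a) $\hat 0,\hat 1$ and all monomial terms are in $U$; (b) if $s,t\in U\setminus\{\hat 0\}$ then $s\hat+t\in U$; (c) if $s$ is a monomial term and $t\in U\setminus\{\hat 0,\hat 1\}$ then $s\hat\times t\in U$. Terms arising by (b) (resp. (c)) are sum (resp. product) polynomial terms. $\mathbb{N}_{\mathrm{rd}}[X]=\{[t]_{\mathrm{AC}}\mid t\in \mathrm{PT}(X)\}$ (polynomials); classes of sum (product) polynomial terms are sum (product) polynomials. Facts making the next definition meaningful: every polynomial outside $X/\mathrm{AC}\cup\{0,1\}$ is exactly one of a sum polynomial or a product polynomial; each sum polynomial is $q_1+\dots+q_n$ with $n\ge2$ and each $q_i$ a product polynomial or in $X/\mathrm{AC}\cup\{1\}$, uniquely up to permutation; each product polynomial that is not a monomial is $m\times q'$ for a unique monomial $m$ and unique sum polynomial $q'$. Multiplication $\times_{\mathrm{rd}}$ on $\mathbb{N}_{\mathrm{rd}}[X]$,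 by induction on $\mathrm{size}(q)$: $q\times_{\mathrm{rd}}0=0\times_{\mathrm{rd}}q=0$, $q\times_{\mathrm{rd}}1=1\times_{\mathrm{rd}}q=q$; for $q,r\notin\{0,1\}$: if $q$ is a monomial, $q\times_{\mathrm{rd}}r=q\times r$; if $q$ is a sum polynomial, written as $q=q_1+\dots+q_n$ with $n\ge2$ and each $q_i$ a product polynomial or in $X/\mathrm{AC}\cup\{1\}$, $q\times_{\mathrm{rd}}r=q_1\times_{\mathrm{rd}}r+\dots+q_n\times_{\mathrm{rd}}r$; if $q=m\times q'$ with $m$ a monomial and $q'$ a sum polynomial, $q\times_{\mathrm{rd}}r=m\times(q'\times_{\mathrm{rd}}r)$. The term $s\langle\hat\times t\rangle$ for $s,t\in \mathrm{PT}(X)\setminus\{\hat0\}$: a monomial term $v$ occurs as a summand in $s$ if $s=v$ or an occurrence of $v$ is a child of a $\hat+$-symbol in $s$. Put $\hat1\langle\hat\times t\rangle=t$ and $s\langle\hat\times\hat1\rangle=s$; if $s\in X$ and $t\neq\hat1$, put $s\langle\hat\times t\rangle=s\hat\times t$. If $\mathrm{size}(s)\ge2$ (and $t\ne\hat1$), $s\langle\hat\times t\rangle$ is obtained from $s$ by replacing each occurrence of the leaf $\hat1$ by $t$, and replacing each leaf $x\in X$ which is the rightmost factor of a monomial term occurring as a summand in $s$ by $x\hat\times t$. *)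

theory Defs
  imports Main
begin

section \<open>Terms\<close>

text \<open>The set \<open>X\<close> is a type variable \<open>'x\<close>; every HOL type is nonempty.\<close>

datatype 'x trm =
    Zero
  | One
  | Var 'x
  | Plus "'x trm" "'x trm"
  | Times "'x trm" "'x trm"

fun subterms :: "'x trm \<Rightarrow> 'x trm set" where
  "subterms (Plus a b) = insert (Plus a b) (subterms a \<union> subterms b)"
| "subterms (Times a b) = insert (Times a b) (subterms a \<union> subterms b)"
| "subterms t = {t}"

definition simple :: "'x trm \<Rightarrow> bool" where
  "simple s \<longleftrightarrow> s = Zero \<or>
     (Zero \<notin> subterms s \<and>
      (\<forall>s'. Times One s' \<notin> subterms s \<and> Times s' One \<notin> subterms s))"


section \<open>Equality modulo associativity and commutativity\<close>

inductive ac_axiom :: "'x trm \<Rightarrow> 'x trm \<Rightarrow> bool" where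
  plus_assoc: "ac_axiom (Plus a (Plus b c)) (Plus (Plus a b) c)"
| plus_comm: "ac_axiom (Plus a b) (Plus b a)"
| times_assoc: "ac_axiom (Times a (Times b c)) (Times (Times a b) c)"

inductive ac_step :: "'x trm \<Rightarrow> 'x trm \<Rightarrow> bool" where
  forward: "ac_axiom s t \<Longrightarrow> ac_step s t"
| backward: "ac_axiom t s \<Longrightarrow> ac_step s t"
| plus_left: "ac_step a a' \<Longrightarrow> ac_step (Plus a b) (Plus a' b)"
| plus_right: "ac_step b b' \<Longrightarrow> ac_step (Plus a b) (Plus a b')"
| times_left: "ac_step a a' \<Longrightarrow> ac_step (Times a b) (Times a' b)"
| times_right: "ac_step b b' \<Longrightarrow> ac_step (Times a b) (Times a b')"

definition ac_eq :: "'x trm \<Rightarrow> 'x trm \<Rightarrow> bool" where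
  "ac_eq s t \<longleftrightarrow> simple s \<and> simple t \<and> ac_step\<^sup>*\<^sup>* s t"

lemma ac_step_sym: "ac_step s t \<Longrightarrow> ac_step t s"
  by (induction rule: ac_step.induct) (auto intro: ac_step.intros)

lemma ac_steps_sym: "ac_step\<^sup>*\<^sup>* s t \<Longrightarrow> ac_step\<^sup>*\<^sup>* t s"
  by (induction rule: rtranclp_induct) (blast intro: ac_step_sym converse_rtranclp_into_rtranclp)+

lemma ac_steps_plus:
  assumes "ac_step\<^sup>*\<^sup>* a a'" "ac_step\<^sup>*\<^sup>* b b'"
  shows "ac_step\<^sup>*\<^sup>* (Plus a b) (Plus a' b')"
proof -
  have "ac_step\<^sup>*\<^sup>* (Plus a b) (Plus a' b)" using assms(1)
    by (induction rule: rtranclp_induct) (auto intro: plus_left rtranclp.rtrancl_into_rtrancl)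
  also have "ac_step\<^sup>*\<^sup>* (Plus a' b) (Plus a' b')" using assms(2)
    by (induction rule: rtranclp_induct) (auto intro: plus_right rtranclp.rtrancl_into_rtrancl)
  finally show ?thesis .
qed

lemma ac_steps_times:
  assumes "ac_step\<^sup>*\<^sup>* a a'" "ac_step\<^sup>*\<^sup>* b b'"
  shows "ac_step\<^sup>*\<^sup>* (Times a b) (Times a' b')"
proof -
  have "ac_step\<^sup>*\<^sup>* (Times a b) (Times a' b)" using assms(1)
    by (induction rule: rtranclp_induct) (auto intro: times_left rtranclp.rtrancl_into_rtrancl)
  also have "ac_step\<^sup>*\<^sup>* (Times a' b) (Times a' b')" using assms(2)
    by (induction rule: rtranclp_induct) (auto intro: times_right rtranclp.rtrancl_into_rtrancl)
  finally show ?thesis .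
qed

lemma ac_step_from_const: "ac_step s t \<Longrightarrow> s \<noteq> Zero \<and> s \<noteq> One"
  by (induction rule: ac_step.induct) (auto elim: ac_axiom.cases)

lemma ac_steps_Zero: "ac_step\<^sup>*\<^sup>* s t \<Longrightarrow> s = Zero \<longleftrightarrow> t = Zero"
  by (induction rule: rtranclp_induct) (use ac_step_from_const ac_step_sym in blast)+

lemma ac_steps_One: "ac_step\<^sup>*\<^sup>* s t \<Longrightarrow> s = One \<longleftrightarrow> t = One"
  by (induction rule: rtranclp_induct) (use ac_step_from_const ac_step_sym in blast)+

lemma self_in_subterms [simp]: "s \<in> subterms s"
  by (cases s) auto

lemma simple_Zero [simp]: "simple Zero" and simple_One [simp]: "simple One"
  and simple_Var [simp]: "simple (Var x)"
  by (auto simp: simple_def)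

lemma simple_Plus [simp]:
  "simple (Plus a b) \<longleftrightarrow> simple a \<and> simple b \<and> a \<noteq> Zero \<and> b \<noteq> Zero"
  by (auto simp: simple_def)

lemma simple_Times [simp]:
  "simple (Times a b) \<longleftrightarrow>
     simple a \<and> simple b \<and> a \<notin> {Zero, One} \<and> b \<notin> {Zero, One}"
  by (auto simp: simple_def)


section \<open>The quotient of simple terms\<close>

quotient_type 'x nsb = "'x trm" / partial: ac_eq
proof (rule part_equivpI)
  show "\<exists>s :: 'x trm. ac_eq s s" by (rule exI[of _ Zero]) (simp add: ac_eq_def)
  show "symp (ac_eq :: 'x trm \<Rightarrow> _)" by (rule sympI) (simp add: ac_eq_def ac_steps_sym)
  show "transp (ac_eq :: 'x trm \<Rightarrow> _)" by (rule transpI) (auto simp: ac_eq_def)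
qed

definition ac_class :: "'x trm \<Rightarrow> 'x nsb" (\<open>[_]\<^bsub>AC\<^esub>\<close>) where
  "[s]\<^bsub>AC\<^esub> = abs_nsb s"

lemma ac_class_eq_iff:
  "simple s \<Longrightarrow> simple t \<Longrightarrow> [s]\<^bsub>AC\<^esub> = [t]\<^bsub>AC\<^esub> \<longleftrightarrow> ac_eq s t"
  unfolding ac_class_def
  using Quotient3_rel[OF Quotient3_nsb, of s t] by (auto simp: ac_eq_def)

instantiation nsb :: (type) "{zero, one, plus, times}"
begin

lift_definition zero_nsb :: "'x nsb" is Zero by (simp add: ac_eq_def)

lift_definition one_nsb :: "'x nsb" is One by (simp add: ac_eq_def)

lift_definition plus_nsb :: "'x nsb \<Rightarrow> 'x nsb \<Rightarrow> 'x nsb" is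
  "\<lambda>s t. if s = Zero then t else if t = Zero then s else Plus s t"
  subgoal for s s' t t'
    using ac_steps_Zero[of s s'] ac_steps_Zero[of t t'] by (auto simp: ac_eq_def ac_steps_plus)
  done

lift_definition times_nsb :: "'x nsb \<Rightarrow> 'x nsb \<Rightarrow> 'x nsb" is
  "\<lambda>s t. if s = Zero \<or> t = Zero then Zero
         else if s = One then t else if t = One then s else Times s t"
  subgoal for s s' t t'
    using ac_steps_Zero[of s s'] ac_steps_Zero[of t t'] ac_steps_One[of s s'] ac_steps_One[of t t']
    by (auto simp: ac_eq_def ac_steps_times)
  done

instance ..

end

instance nsb :: (type) comm_monoid_add
proof
  fix a b c :: "'x nsb"
  show "a + b + c = a + (b + c)"
    by transfer (auto simp: ac_eq_def intro: ac_step.intros ac_axiom.intros)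
  show "a + b = b + a"
    by transfer (auto simp: ac_eq_def intro: ac_step.intros ac_axiom.intros)
  show "0 + a = a"
    by transfer auto
qed

instance nsb :: (type) "{monoid_mult, mult_zero}"
proof
  fix a b c :: "'x nsb"
  show "a * b * c = a * (b * c)"
    by transfer (auto simp: ac_eq_def intro: ac_step.intros ac_axiom.intros)
  show "1 * a = a" "a * 1 = a" "0 * a = 0" "a * 0 = 0"
    by (transfer; auto simp: ac_eq_def)+
qed


section \<open>Polynomials\<close>

inductive_set MT :: "'x trm set" where
  "Var x \<in> MT"
| "s \<in> MT \<Longrightarrow> t \<in> MT \<Longrightarrow> Times s t \<in> MT"

inductive_set PT :: "'x trm set" where
  zero: "Zero \<in> PT"
| one: "One \<in> PT"
| monomial: "s \<in> MT \<Longrightarrow> s \<in> PT"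
| sum: "s \<in> PT \<Longrightarrow> s \<noteq> Zero \<Longrightarrow> t \<in> PT \<Longrightarrow> t \<noteq> Zero \<Longrightarrow> Plus s t \<in> PT"
| product: "s \<in> MT \<Longrightarrow> t \<in> PT \<Longrightarrow> t \<noteq> Zero \<Longrightarrow> t \<noteq> One \<Longrightarrow> Times s t \<in> PT"

lemma simple_MT: "s \<in> MT \<Longrightarrow> simple s \<and> s \<noteq> Zero \<and> s \<noteq> One"
  by (induction rule: MT.induct) auto

lemma simple_PT: "s \<in> PT \<Longrightarrow> simple s"
  by (induction rule: PT.induct) (auto dest: simple_MT)

definition sum_PT :: "'x trm set" where
  "sum_PT = {Plus s t | s t. s \<in> PT - {Zero} \<and> t \<in> PT - {Zero}}"

definition prod_PT :: "'x trm set" where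
  "prod_PT = {Times s t | s t. s \<in> MT \<and> t \<in> PT - {Zero, One}}"

definition X_AC :: "'x nsb set" where
  "X_AC = {[Var x]\<^bsub>AC\<^esub> | x. True}"

definition monomials :: "'x nsb set" where
  "monomials = {[s]\<^bsub>AC\<^esub> | s. s \<in> MT}"

definition Nrd :: "'x nsb set" where
  "Nrd = {[s]\<^bsub>AC\<^esub> | s. s \<in> PT}"

definition sum_polys :: "'x nsb set" where
  "sum_polys = {[s]\<^bsub>AC\<^esub> | s. s \<in> sum_PT}"

definition prod_polys :: "'x nsb set" where
  "prod_polys = {[s]\<^bsub>AC\<^esub> | s. s \<in> prod_PT}"

text \<open>
  The multiplication on \<^term>\<open>Nrd\<close> is defined by recursion on the size of the left factor,
  where the recursive clauses use decompositions that are unique (for sums, up to permutation).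
  It is given here by its graph, one rule per clause; \<open>rd_times\<close> picks the unique value
  related to the two factors.
\<close>

inductive rd_graph :: "'x nsb \<Rightarrow> 'x nsb \<Rightarrow> 'x nsb \<Rightarrow> bool" where
  right_zero: "q \<in> Nrd \<Longrightarrow> rd_graph q 0 0"
| left_zero: "q \<in> Nrd \<Longrightarrow> rd_graph 0 q 0"
| right_one: "q \<in> Nrd \<Longrightarrow> rd_graph q 1 q"
| left_one: "q \<in> Nrd \<Longrightarrow> rd_graph 1 q q"
| monomial: "q \<in> monomials \<Longrightarrow> r \<in> Nrd - {0, 1} \<Longrightarrow> rd_graph q r (q * r)"
| sum: "q \<in> sum_polys \<Longrightarrow> r \<in> Nrd - {0, 1} \<Longrightarrow>
    q = sum_list qs \<Longrightarrow> length qs \<ge> 2 \<Longrightarrow> set qs \<subseteq> prod_polys \<union> X_AC \<union> {1} \<Longrightarrow>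
    list_all2 (\<lambda>qi p. rd_graph qi r p) qs ps \<Longrightarrow> rd_graph q r (sum_list ps)"
| product: "m \<in> monomials \<Longrightarrow> q' \<in> sum_polys \<Longrightarrow> r \<in> Nrd - {0, 1} \<Longrightarrow>
    rd_graph q' r p \<Longrightarrow> rd_graph (m * q') r (m * p)"

definition rd_times :: "'x nsb \<Rightarrow> 'x nsb \<Rightarrow> 'x nsb" (infixl \<open>\<times>\<^sub>r\<^sub>d\<close> 70) where
  "q \<times>\<^sub>r\<^sub>d r = (THE p. rd_graph q r p)"


section \<open>The term obtained by multiplying at the leaves\<close>

text \<open>Occurrences in a term are addressed by paths from the root.\<close>

datatype side = Lft | Rgt

fun subterm_at :: "'x trm \<Rightarrow> side list \<Rightarrow> 'x trm option" where
  "subterm_at s [] = Some s"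
| "subterm_at (Plus a b) (Lft # p) = subterm_at a p"
| "subterm_at (Plus a b) (Rgt # p) = subterm_at b p"
| "subterm_at (Times a b) (Lft # p) = subterm_at a p"
| "subterm_at (Times a b) (Rgt # p) = subterm_at b p"
| "subterm_at _ _ = None"

definition summand_at :: "'x trm \<Rightarrow> 'x trm \<Rightarrow> side list \<Rightarrow> bool" where
  "summand_at v s p \<longleftrightarrow> v \<in> MT \<and> subterm_at s p = Some v \<and>
     (p = [] \<or> (\<exists>p' d a b. p = p' @ [d] \<and> subterm_at s p' = Some (Plus a b)))"

definition rightmost_factor_at :: "'x trm \<Rightarrow> side list \<Rightarrow> bool" where
  "rightmost_factor_at s p \<longleftrightarrow>
     (\<exists>v q k x. summand_at v s q \<and> p = q @ replicate k Rgt \<and> subterm_at s p = Some (Var x))"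

fun map_leaves :: "(side list \<Rightarrow> 'x trm \<Rightarrow> 'x trm) \<Rightarrow> 'x trm \<Rightarrow> 'x trm" where
  "map_leaves f (Plus a b) =
     Plus (map_leaves (\<lambda>p. f (Lft # p)) a) (map_leaves (\<lambda>p. f (Rgt # p)) b)"
| "map_leaves f (Times a b) =
     Times (map_leaves (\<lambda>p. f (Lft # p)) a) (map_leaves (\<lambda>p. f (Rgt # p)) b)"
| "map_leaves f l = f [] l"

text \<open>
  Only used for \<open>s\<close> and \<open>t\<close> in \<^term>\<open>PT - {Zero}\<close>; there the last case is exactly
  that of an \<open>s\<close> with at least two symbols.
\<close>

definition leaf_times :: "'x trm \<Rightarrow> 'x trm \<Rightarrow> 'x trm" (\<open>_\<langle>\<times> _\<rangle>\<close> [1000, 0] 1000) where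
  "s\<langle>\<times> t\<rangle> =
     (if s = One then t
      else if t = One then s
      else if s \<in> range Var then Times s t
      else map_leaves
        (\<lambda>p l. if l = One then t else if rightmost_factor_at s p then Times l t else l) s)"

end

theory Submission
  imports Defs
begin

text \<open>
  Fix \<open>r\<close>. On terms, multiplying every rightmost leaf by \<open>r\<close> is a structural recursion:
  \<open>1\<close> goes to \<open>r\<close>, a variable \<open>x\<close> to \<open>x \<times> r\<close>, a sum is treated summandwise, and in a product
  only the right factor is changed. Taking values in the quotient gives \<open>val_times r\<close>, which
  respects the three AC axioms because the quotient is a commutative monoid under \<open>+\<close> and a
  monoid under \<open>\<times>\<close>. Hence it descends to a function \<open>leaf_mult r\<close> on classes
  (\<open>leaf_mult_class\<close>).

  This function satisfies every defining clause of the multiplication of polynomials, so it contains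
  its graph (\<open>rd_graph_leaf_mult\<close>). The values of the multiplication are therefore
  unique. Conversely, splitting a polynomial term into its summands, and gathering the monomial
  factors in front of a sum, shows that the graph has a value at every nonzero left factor if the
  right one is not \<open>0\<close> or \<open>1\<close> (\<open>rd_graph_exists\<close>). So \<open>[s] \<times>\<^sub>r\<^sub>d [t]\<close> is \<open>val_times [t] s\<close>
  for such \<open>t\<close>.

  It remains to see that \<open>s\<langle>\<times> t\<rangle>\<close>, which is given by positions, obeys the same structural
  recursion on polynomial terms for \<open>t \<noteq> 1\<close> (\<open>leaf_times_eq_append_factor\<close>). For \<open>t = 1\<close> both sides
  are \<open>[s]\<close> at once.
\<close>

section \<open>The shape of polynomial terms\<close>

lemma MT_subset_PT: "s \<in> MT \<Longrightarrow> s \<in> PT - {Zero, One}"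
  using PT.monomial simple_MT by auto

lemma Times_mem_MT_iff [simp]: "Times a b \<in> MT \<longleftrightarrow> a \<in> MT \<and> b \<in> MT"
  by (auto intro: MT.intros elim: MT.cases)

lemma Plus_notin_MT [simp]: "Plus a b \<notin> MT"
  by (auto elim: MT.cases)

lemma Var_mem_MT [simp]: "Var x \<in> MT"
  by (rule MT.intros)

text \<open>
  A monomial term is a variable or a product of two monomial terms, and the second kind is
  already an instance of the product clause. This leaves variables as the only monomials to be
  treated in an induction.
\<close>

lemma PT_nonzero_induct [consumes 1, case_names One Var Plus Times]:
  assumes "s \<in> PT - {Zero}"
    and One: "P One"
    and Var: "\<And>x. P (Var x)"
    and Plus: "\<And>a b. a \<in> PT - {Zero} \<Longrightarrow> b \<in> PT - {Zero} \<Longrightarrow> P a \<Longrightarrow> P b \<Longrightarrow> P (Plus a b)"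
    and Times: "\<And>a b. a \<in> MT \<Longrightarrow> b \<in> PT - {Zero, One} \<Longrightarrow> P b \<Longrightarrow> P (Times a b)"
  shows "P s"
proof -
  have mono: "P m" if "m \<in> MT" for m
    using that by (induction rule: MT.induct) (use Var Times MT_subset_PT in blast)+
  have "s \<in> PT" "s \<noteq> Zero" using assms(1) by auto
  then show ?thesis
    by (induction rule: PT.induct) (auto intro: One mono Plus Times)
qed


section \<open>Multiplication at the leaves on AC-classes\<close>

fun val :: "'x trm \<Rightarrow> 'x nsb" where
  "val Zero = 0"
| "val One = 1"
| "val (Var x) = [Var x]\<^bsub>AC\<^esub>"
| "val (Plus a b) = val a + val b"
| "val (Times a b) = val a * val b"

fun val_times :: "'x nsb \<Rightarrow> 'x trm \<Rightarrow> 'x nsb" where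
  "val_times r Zero = 0"
| "val_times r One = r"
| "val_times r (Var x) = [Var x]\<^bsub>AC\<^esub> * r"
| "val_times r (Plus a b) = val_times r a + val_times r b"
| "val_times r (Times a b) = val a * val_times r b"

lemma class_Zero: "[Zero]\<^bsub>AC\<^esub> = 0"
  by (simp add: ac_class_def zero_nsb.abs_eq)

lemma class_One: "[One]\<^bsub>AC\<^esub> = 1"
  by (simp add: ac_class_def one_nsb.abs_eq)

lemma class_Plus: "simple (Plus a b) \<Longrightarrow> [Plus a b]\<^bsub>AC\<^esub> = [a]\<^bsub>AC\<^esub> + [b]\<^bsub>AC\<^esub>"
  by (simp add: ac_class_def plus_nsb.abs_eq ac_eq_def)

lemma class_Times: "simple (Times a b) \<Longrightarrow> [Times a b]\<^bsub>AC\<^esub> = [a]\<^bsub>AC\<^esub> * [b]\<^bsub>AC\<^esub>"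
  by (simp add: ac_class_def times_nsb.abs_eq ac_eq_def)

lemma class_eq_val: "simple s \<Longrightarrow> [s]\<^bsub>AC\<^esub> = val s"
  by (induction s) (simp_all add: class_Zero class_One class_Plus class_Times)

lemma class_neq_constants:
  assumes "simple s" "s \<notin> {Zero, One}"
  shows "[s]\<^bsub>AC\<^esub> \<notin> {0, 1}"
  using assms ac_class_eq_iff[of s Zero] ac_class_eq_iff[of s One]
    ac_steps_Zero[of s Zero] ac_steps_One[of s One]
  by (auto simp: ac_eq_def class_Zero class_One)

lemma val_ac_step: "ac_step s t \<Longrightarrow> val s = val t"
  by (induction rule: ac_step.induct) (auto elim!: ac_axiom.cases simp: ac_simps)

text \<open>
  Associativity of \<open>\<times>\<close> is what makes it possible to change only the right factor: both
  bracketings of a product carry the extra factor at their last leaf.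
\<close>

lemma val_times_ac_step: "ac_step s t \<Longrightarrow> val_times r s = val_times r t"
  by (induction rule: ac_step.induct)
    (auto elim!: ac_axiom.cases simp: ac_simps dest: val_ac_step)

lemma val_times_ac_eq: "ac_eq s t \<Longrightarrow> val_times r s = val_times r t"
  unfolding ac_eq_def
  by (elim conjE, erule rtranclp_induct) (auto dest: val_ac_step val_times_ac_step)

text \<open>
  A representative is chosen here; by the preceding lemma the value is the same for all of them.
\<close>

definition leaf_mult :: "'x nsb \<Rightarrow> 'x nsb \<Rightarrow> 'x nsb" where
  "leaf_mult r q = val_times r (rep_nsb q)"

lemma class_surj: obtains s where "simple s" "q = [s]\<^bsub>AC\<^esub>"
proof
  show "simple (rep_nsb q)"
    using Quotient3_rep_reflp[OF Quotient3_nsb] by (auto simp: ac_eq_def)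
  show "q = [rep_nsb q]\<^bsub>AC\<^esub>"
    by (simp add: ac_class_def Quotient3_abs_rep[OF Quotient3_nsb])
qed

lemma leaf_mult_class:
  assumes "simple s"
  shows "leaf_mult r [s]\<^bsub>AC\<^esub> = val_times r s"
proof -
  have "ac_eq s s" using assms by (simp add: ac_eq_def)
  then have "ac_eq (rep_nsb [s]\<^bsub>AC\<^esub>) s"
    by (simp add: ac_class_def rep_abs_rsp_left[OF Quotient3_nsb])
  then show ?thesis
    unfolding leaf_mult_def by (rule val_times_ac_eq)
qed

lemma leaf_mult_0 [simp]: "leaf_mult r 0 = 0"
  using leaf_mult_class[of Zero] by (simp add: class_Zero)

lemma leaf_mult_1 [simp]: "leaf_mult r 1 = r"
  using leaf_mult_class[of One] by (simp add: class_One)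

lemma leaf_mult_by_0 [simp]: "leaf_mult 0 q = 0"
proof -
  have "val_times 0 s = 0" for s :: "'x trm" by (induction s) auto
  then show ?thesis by (simp add: leaf_mult_def)
qed

lemma leaf_mult_by_1 [simp]: "leaf_mult 1 q = q"
proof -
  have val: "val_times 1 s = val s" for s :: "'x trm" by (induction s) auto
  obtain s where "simple s" "q = [s]\<^bsub>AC\<^esub>" by (rule class_surj)
  then show ?thesis using leaf_mult_class[of s 1] by (simp add: val class_eq_val)
qed

lemma leaf_mult_add: "leaf_mult r (p + q) = leaf_mult r p + leaf_mult r q"
proof -
  obtain a where a: "simple a" "p = [a]\<^bsub>AC\<^esub>" by (rule class_surj)
  obtain b where b: "simple b" "q = [b]\<^bsub>AC\<^esub>" by (rule class_surj)
  show ?thesis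
  proof (cases "a = Zero \<or> b = Zero")
    case True
    with a b show ?thesis by (auto simp: class_Zero)
  next
    case False
    with a b have "simple (Plus a b)" by simp
    with a b show ?thesis
      using leaf_mult_class[of "Plus a b" r] by (simp add: class_Plus leaf_mult_class)
  qed
qed

lemma leaf_mult_sum_list: "leaf_mult r (sum_list qs) = sum_list (map (leaf_mult r) qs)"
  by (induction qs) (auto simp: leaf_mult_add)

lemma leaf_mult_monomial:
  assumes "m \<in> monomials"
  shows "leaf_mult r m = m * r"
proof -
  obtain s where s: "s \<in> MT" "m = [s]\<^bsub>AC\<^esub>" using assms by (auto simp: monomials_def)
  from s(1) have "val_times r s = val s * r"
    by (induction rule: MT.induct) (auto simp: mult.assoc)
  with s show ?thesis using leaf_mult_class[of s r] by (simp add: class_eq_val simple_MT)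
qed

text \<open>
  For \<open>q = 1\<close> an arbitrary left factor would not do, since \<open>leaf_mult r\<close> changes all
  summands of a sum \<open>m\<close>, whereas \<open>\<times>\<close> does not distribute over \<open>+\<close>.
\<close>

lemma leaf_mult_monomial_times:
  assumes "m \<in> monomials"
  shows "leaf_mult r (m * q) = m * leaf_mult r q"
proof -
  obtain s where s: "s \<in> MT" "m = [s]\<^bsub>AC\<^esub>" using assms by (auto simp: monomials_def)
  obtain b where b: "simple b" "q = [b]\<^bsub>AC\<^esub>" by (rule class_surj)
  consider "b = Zero" | "b = One" | "b \<notin> {Zero, One}" by blast
  then show ?thesis
  proof cases
    case 1
    with b show ?thesis by (simp add: class_Zero)
  next
    case 2
    with b assms show ?thesis by (simp add: class_One leaf_mult_monomial)
  next
    case 3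
    with s b have "simple (Times s b)" by (auto dest: simple_MT)
    with s b show ?thesis
      using leaf_mult_class[of "Times s b" r] leaf_mult_class[of b r]
      by (simp add: class_eq_val)
  qed
qed


section \<open>The multiplication of polynomials is a function\<close>

text \<open>
  Each clause of the definition of the multiplication is one of the algebraic laws of
  \<open>leaf_mult\<close>. The left factor thus determines the value regardless of the decomposition used.
\<close>

lemma rd_graph_leaf_mult: "rd_graph q r p \<Longrightarrow> p = leaf_mult r q"
proof (induction rule: rd_graph.induct)
  case (sum q r qs ps)
  from sum(6) have "ps = map (leaf_mult r) qs"
    by (induction rule: list_all2_induct) auto
  with sum show ?case by (simp add: leaf_mult_sum_list)
qed (auto simp: leaf_mult_monomial leaf_mult_monomial_times)

lemma rd_times_eqI: "rd_graph q r p \<Longrightarrow> q \<times>\<^sub>r\<^sub>d r = p"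
  unfolding rd_times_def using rd_graph_leaf_mult by (metis the_equality)

fun summands :: "'x trm \<Rightarrow> 'x trm list" where
  "summands (Plus a b) = summands a @ summands b"
| "summands s = [s]"

lemma summands_nonempty: "summands s \<noteq> []"
  by (induction s) auto

lemma sum_list_summands:
  "s \<in> PT - {Zero} \<Longrightarrow> sum_list (map ac_class (summands s)) = [s]\<^bsub>AC\<^esub>"
  by (induction rule: PT_nonzero_induct) (auto simp: class_Plus simple_PT)

lemma summands_classes:
  "s \<in> PT - {Zero} \<Longrightarrow> ac_class ` set (summands s) \<subseteq> prod_polys \<union> X_AC \<union> {1}"
proof (induction rule: PT_nonzero_induct)
  case (Times a b)
  then have "Times a b \<in> prod_PT" by (auto simp: prod_PT_def)
  then show ?case by (auto simp: prod_polys_def)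
next
  case (Plus a b)
  then show ?case by (simp add: image_Un)
qed (auto simp: class_One X_AC_def)

lemma rd_graph_Plus:
  assumes "a \<in> PT - {Zero}" "b \<in> PT - {Zero}" "r \<in> Nrd - {0, 1}"
    and graph: "\<forall>u \<in> set (summands (Plus a b)). \<exists>p. rd_graph [u]\<^bsub>AC\<^esub> r p"
  shows "\<exists>p. rd_graph [Plus a b]\<^bsub>AC\<^esub> r p"
proof -
  let ?us = "summands (Plus a b)"
  have PT: "Plus a b \<in> PT - {Zero}" using assms by (auto intro: PT.sum)
  from graph obtain g where g: "\<forall>u \<in> set ?us. rd_graph [u]\<^bsub>AC\<^esub> r (g u)"
    by metis
  have "rd_graph [Plus a b]\<^bsub>AC\<^esub> r (sum_list (map g ?us))"
  proof (rule rd_graph.sum)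
    show "[Plus a b]\<^bsub>AC\<^esub> \<in> sum_polys"
      using assms by (auto simp: sum_polys_def sum_PT_def)
    show "[Plus a b]\<^bsub>AC\<^esub> = sum_list (map ac_class ?us)"
      using sum_list_summands[OF PT] by simp
    have "length (summands a) \<ge> 1" "length (summands b) \<ge> 1"
      by (simp_all add: Suc_le_eq summands_nonempty)
    then show "length (map ac_class ?us) \<ge> 2" by simp
    show "set (map ac_class ?us) \<subseteq> prod_polys \<union> X_AC \<union> {1}"
      using summands_classes[OF PT] by (simp del: summands.simps)
    show "list_all2 (\<lambda>qi p. rd_graph qi r p) (map ac_class ?us) (map g ?us)"
      using g by (auto simp: list_all2_conv_all_nth simp del: summands.simps)
  qed (fact assms(3))
  then show ?thesis by blast
qed

text \<open>
  The induction carries two further claims along: the summands are needed for the sum clause, and an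
  additional monomial factor in front is needed for the product clause, whose right factor has to
  be a sum and not again a product.
\<close>

lemma rd_graph_exists_aux:
  assumes "r \<in> Nrd - {0, 1}" "s \<in> PT - {Zero}"
  shows "(\<exists>p. rd_graph [s]\<^bsub>AC\<^esub> r p) \<and>
    (\<forall>u \<in> set (summands s). \<exists>p. rd_graph [u]\<^bsub>AC\<^esub> r p) \<and>
    (s \<noteq> One \<longrightarrow> (\<forall>m \<in> MT. \<exists>p. rd_graph ([m]\<^bsub>AC\<^esub> * [s]\<^bsub>AC\<^esub>) r p))"
  using assms(2)
proof (induction rule: PT_nonzero_induct)
  case One
  then show ?case using rd_graph.left_one[of r] assms by (auto simp: class_One)
next
  case (Var x)
  have mono: "\<exists>p. rd_graph [m]\<^bsub>AC\<^esub> r p" if "m \<in> MT" for m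
    using rd_graph.monomial[of "[m]\<^bsub>AC\<^esub>" r] assms that by (auto simp: monomials_def)
  have "[m]\<^bsub>AC\<^esub> * [Var x]\<^bsub>AC\<^esub> = [Times m (Var x)]\<^bsub>AC\<^esub>" if "m \<in> MT" for m
    using that by (auto simp: class_Times dest: simple_MT)
  then show ?case using mono by simp
next
  case (Plus a b)
  have sums: "\<forall>u \<in> set (summands (Plus a b)). \<exists>p. rd_graph [u]\<^bsub>AC\<^esub> r p"
    using Plus by auto
  then obtain p where p: "rd_graph [Plus a b]\<^bsub>AC\<^esub> r p"
    using rd_graph_Plus Plus(1,2) assms(1) by blast
  have "[Plus a b]\<^bsub>AC\<^esub> \<in> sum_polys"
    using Plus by (auto simp: sum_polys_def sum_PT_def)
  then have "rd_graph ([m]\<^bsub>AC\<^esub> * [Plus a b]\<^bsub>AC\<^esub>) r ([m]\<^bsub>AC\<^esub> * p)" if "m \<in> MT" for m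
    using that p assms(1) by (intro rd_graph.product) (auto simp: monomials_def)
  with sums p show ?case by blast
next
  case (Times a b)
  have eq: "[Times a b]\<^bsub>AC\<^esub> = [a]\<^bsub>AC\<^esub> * [b]\<^bsub>AC\<^esub>"
    using Times by (intro class_Times) (auto dest: simple_MT simple_PT)
  have "\<exists>p. rd_graph ([m]\<^bsub>AC\<^esub> * [Times a b]\<^bsub>AC\<^esub>) r p" if m: "m \<in> MT" for m
  proof -
    have "[m]\<^bsub>AC\<^esub> * [Times a b]\<^bsub>AC\<^esub> = [Times m a]\<^bsub>AC\<^esub> * [b]\<^bsub>AC\<^esub>"
      using m Times(1) class_Times[of m a] simple_MT[of m] simple_MT[of a]
      by (simp add: eq mult.assoc)
    moreover have "Times m a \<in> MT" using m Times(1) by simp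
    ultimately show ?thesis using Times by auto
  qed
  moreover have "\<exists>p. rd_graph [Times a b]\<^bsub>AC\<^esub> r p"
    using Times by (auto simp: eq)
  ultimately show ?case by simp
qed

lemma rd_graph_exists:
  "r \<in> Nrd - {0, 1} \<Longrightarrow> s \<in> PT - {Zero} \<Longrightarrow> \<exists>p. rd_graph [s]\<^bsub>AC\<^esub> r p"
  using rd_graph_exists_aux by blast

lemma rd_times_eq_val_times:
  assumes "s \<in> PT - {Zero}" "r \<in> Nrd - {0, 1}"
  shows "[s]\<^bsub>AC\<^esub> \<times>\<^sub>r\<^sub>d r = val_times r s"
proof -
  obtain p where p: "rd_graph [s]\<^bsub>AC\<^esub> r p"
    using rd_graph_exists assms by blast
  then have "p = val_times r s"
    using rd_graph_leaf_mult leaf_mult_class assms(1) simple_PT by blast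
  with p show ?thesis by (simp add: rd_times_eqI)
qed


section \<open>Multiplication at the leaves of a term\<close>

fun append_factor :: "'x trm \<Rightarrow> 'x trm \<Rightarrow> 'x trm" where
  "append_factor t Zero = Zero"
| "append_factor t One = t"
| "append_factor t (Var x) = Times (Var x) t"
| "append_factor t (Plus a b) = Plus (append_factor t a) (append_factor t b)"
| "append_factor t (Times a b) = Times a (append_factor t b)"

lemma val_append_factor: "val (append_factor t s) = val_times (val t) s"
  by (induction s) auto

lemma append_factor_PT:
  assumes "t \<in> PT - {Zero, One}" "s \<in> PT - {Zero}"
  shows "append_factor t s \<in> PT - {Zero, One}"
  using assms(2)
proof (induction rule: PT_nonzero_induct)
  case One
  with assms(1) show ?case by simp
next
  case (Var x)
  with assms(1) show ?case by (auto intro: PT.product)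
next
  case (Plus a b)
  then show ?case by (auto intro: PT.sum)
next
  case (Times a b)
  then show ?case by (auto intro: PT.product)
qed

lemma no_Plus_in_MT: "s \<in> MT \<Longrightarrow> subterm_at s p \<noteq> Some (Plus a b)"
proof (induction arbitrary: p rule: MT.induct)
  case (1 x)
  then show ?case by (cases p) auto
next
  case (2 s t)
  then show ?case
  proof (cases p)
    case (Cons d q)
    with 2 show ?thesis by (cases d) auto
  qed simp
qed

lemma summand_at_Plus:
  "summand_at v (Plus a b) (d # q) \<longleftrightarrow> summand_at v (case d of Lft \<Rightarrow> a | Rgt \<Rightarrow> b) q"
  unfolding summand_at_def
  by (cases d; cases q) (auto simp: Cons_eq_append_conv)

text \<open>
  A child of \<open>\<times>\<close> is not a summand, although it is one when regarded as a term by itself if it is a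
  monomial term; hence \<open>q \<noteq> []\<close>.
\<close>

lemma summand_at_Times:
  "summand_at v (Times a b) (d # q) \<longleftrightarrow>
    q \<noteq> [] \<and> summand_at v (case d of Lft \<Rightarrow> a | Rgt \<Rightarrow> b) q"
  unfolding summand_at_def
  by (cases d; cases q) (auto simp: Cons_eq_append_conv)

lemma summand_at_MT: "a \<in> MT \<Longrightarrow> summand_at v a q \<Longrightarrow> q = [] \<and> v = a"
  using no_Plus_in_MT by (auto simp: summand_at_def)

lemma summand_at_Nil [simp]: "summand_at v s [] \<longleftrightarrow> v = s \<and> s \<in> MT"
  by (auto simp: summand_at_def)

text \<open>
  The summand at the root, present only in a monomial term, is separated from those inside a
  branch, whose positions are read off in the corresponding child.
\<close>

lemma rightmost_factor_at_Cons:
  "rightmost_factor_at s (d # p) \<longleftrightarrow>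
    (\<exists>x. subterm_at s (d # p) = Some (Var x)) \<and>
    (s \<in> MT \<and> (\<exists>k. d # p = replicate k Rgt) \<or>
     (\<exists>v q k. summand_at v s (d # q) \<and> p = q @ replicate k Rgt))"
  (is "?L \<longleftrightarrow> ?R")
proof
  assume ?L
  then obtain v q k x where *: "summand_at v s q" "d # p = q @ replicate k Rgt"
    "subterm_at s (d # p) = Some (Var x)"
    unfolding rightmost_factor_at_def by blast
  then show ?R by (cases q) auto
next
  assume ?R
  then consider x k where "subterm_at s (d # p) = Some (Var x)" "s \<in> MT" "d # p = replicate k Rgt"
    | x v q k where "subterm_at s (d # p) = Some (Var x)" "summand_at v s (d # q)"
      "p = q @ replicate k Rgt"
    by blast
  then show ?L
  proof cases
    case 1
    then have "summand_at s s []" "d # p = [] @ replicate k Rgt" by simp_all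
    with 1(1) show ?thesis unfolding rightmost_factor_at_def by blast
  next
    case 2
    then have "d # p = (d # q) @ replicate k Rgt" by simp
    with 2(1,2) show ?thesis unfolding rightmost_factor_at_def by blast
  qed
qed

lemma rightmost_factor_at_Plus:
  "rightmost_factor_at (Plus a b) (d # p) \<longleftrightarrow>
    rightmost_factor_at (case d of Lft \<Rightarrow> a | Rgt \<Rightarrow> b) p"
  unfolding rightmost_factor_at_Cons
  by (cases d) (auto simp: summand_at_Plus rightmost_factor_at_def)

lemma rightmost_factor_at_Times_Lft:
  assumes "a \<in> MT"
  shows "\<not> rightmost_factor_at (Times a b) (Lft # p)"
  using summand_at_MT[OF assms]
  by (auto simp: rightmost_factor_at_Cons summand_at_Times Cons_replicate_eq)

text \<open>
  With a monomial term on the left, a product is a monomial term exactly if its right factor \<open>b\<close> is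
  one. If so, the summand at the root of \<open>b\<close> is replaced by the whole product, and the two have the
  same rightmost leaf; otherwise all summands lie strictly inside \<open>b\<close>.
\<close>

lemma rightmost_factor_at_Times_Rgt:
  assumes "a \<in> MT"
  shows "rightmost_factor_at (Times a b) (Rgt # p) \<longleftrightarrow> rightmost_factor_at b p"
    (is "?L \<longleftrightarrow> ?R")
proof
  have replicate: "(\<exists>k. Rgt # p = replicate k Rgt) \<longleftrightarrow> (\<exists>k. p = replicate k Rgt)"
    by (metis Cons_replicate_eq replicate_Suc)
  {
    assume ?L
    then consider x k where "subterm_at b p = Some (Var x)" "b \<in> MT" "p = replicate k Rgt"
      | x v q k where "subterm_at b p = Some (Var x)" "summand_at v b q" "p = q @ replicate k Rgt"
      by (auto simp: rightmost_factor_at_Cons summand_at_Times replicate)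
    then show ?R
    proof cases
      case 1
      then have "summand_at b b []" "p = [] @ replicate k Rgt" by simp_all
      with 1(1) show ?thesis unfolding rightmost_factor_at_def by blast
    qed (auto simp: rightmost_factor_at_def)
  }
  assume ?R
  then obtain v q k x where *: "summand_at v b q" "p = q @ replicate k Rgt"
    "subterm_at b p = Some (Var x)"
    unfolding rightmost_factor_at_def by blast
  then show ?L
    using assms replicate
    by (cases "q = []") (auto simp: rightmost_factor_at_Cons summand_at_Times)
qed

lemma map_leaves_MT: "a \<in> MT \<Longrightarrow> map_leaves (\<lambda>p l. if l = One then t else l) a = a"
  by (induction rule: MT.induct) auto

lemma map_leaves_eq_append_factor:
  "s \<in> PT - {Zero} \<Longrightarrow>
    map_leaves (\<lambda>p l. if l = One then t else if rightmost_factor_at s p then Times l t else l) s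
    = append_factor t s"
proof (induction rule: PT_nonzero_induct)
  case (Var x)
  have "rightmost_factor_at (Var x) []"
    unfolding rightmost_factor_at_def by (auto intro!: exI[of _ "[]"])
  then show ?case by simp
next
  case (Times a b)
  then show ?case
    by (simp add: rightmost_factor_at_Times_Lft rightmost_factor_at_Times_Rgt map_leaves_MT
        cong: if_cong)
qed (simp_all add: rightmost_factor_at_Plus cong: if_cong)

lemma leaf_times_eq_append_factor:
  "s \<in> PT - {Zero} \<Longrightarrow> t \<noteq> One \<Longrightarrow> s\<langle>\<times> t\<rangle> = append_factor t s"
  using map_leaves_eq_append_factor[of s t] by (auto simp: leaf_times_def)


section \<open>The product of two polynomials as a term\<close>

theorem lemma4p12:
  fixes s t :: "'x trm"
  assumes "s \<in> PT - {Zero}" and "t \<in> PT - {Zero}"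
  shows "s\<langle>\<times> t\<rangle> \<in> PT \<and> [s]\<^bsub>AC\<^esub> \<times>\<^sub>r\<^sub>d [t]\<^bsub>AC\<^esub> = [s\<langle>\<times> t\<rangle>]\<^bsub>AC\<^esub>"
proof (cases "t = One")
  case True
  have "[s]\<^bsub>AC\<^esub> \<in> Nrd" using assms by (auto simp: Nrd_def)
  then have "[s]\<^bsub>AC\<^esub> \<times>\<^sub>r\<^sub>d 1 = [s]\<^bsub>AC\<^esub>"
    by (intro rd_times_eqI rd_graph.right_one)
  moreover have "s\<langle>\<times> t\<rangle> = s" using True by (simp add: leaf_times_def)
  ultimately show ?thesis using assms True by (simp add: class_One)
next
  case False
  then have t: "t \<in> PT - {Zero, One}" using assms by simp
  have eq: "s\<langle>\<times> t\<rangle> = append_factor t s"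
    using assms(1) False by (rule leaf_times_eq_append_factor)
  have PT: "s\<langle>\<times> t\<rangle> \<in> PT"
    using append_factor_PT[OF t assms(1)] eq by simp
  have "[t]\<^bsub>AC\<^esub> \<in> Nrd - {0, 1}"
    using t class_neq_constants[of t] simple_PT[of t] by (auto simp: Nrd_def)
  then have "[s]\<^bsub>AC\<^esub> \<times>\<^sub>r\<^sub>d [t]\<^bsub>AC\<^esub> = val_times [t]\<^bsub>AC\<^esub> s"
    using assms by (intro rd_times_eq_val_times)
  also have "\<dots> = val (append_factor t s)"
    using t by (simp add: val_append_factor class_eq_val simple_PT)
  also have "\<dots> = [s\<langle>\<times> t\<rangle>]\<^bsub>AC\<^esub>"
    using PT eq by (simp add: class_eq_val simple_PT)
  finally show ?thesis using PT by simp
qed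

end
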